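(* There exist a compact metric space $(X,\rho)$ and a continuous map $T\colon X\to X$ such that the topological dynamical system $(X,T)$ is not Besicovitch complete.
   Context: For a compact metric space $(X,\rho)$ and a continuous map $T\colon X\to X$, the (dynamical) Besicovitch pseudo-metric on $X$ is $\rho_B^T(x,y)=\limsup_{n\to\infty}\frac1n\sum_{j=0}^{n-1}\rho(T^j(x),T^j(y))$. A sequence $\{z^{(n)}\}_{n=0}^\infty$ in $X$ is Besicovitch-Cauchy if for every $\varepsilon>0$ there is $N$ such that $\rho_B^T(z^{(n)},z^{(m)})<\varepsilon$ for all $n,m\ge N$. The system $(X,T)$ is Besicovitch complete if for every Besicovitch-Cauchy sequence $\{z^{(n)}\}_{n=0}^\infty$ in $X$ there is a point $z\in X$ with $\lim_{n\to\infty}\rho_B^T(z^{(n)},z)=0$. *)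

theory Defs
  imports "HOL-Analysis.Analysis"
begin

text \<open>
  Metric spaces are carrier-based (locale \<^locale>\<open>Metric_space\<close>): a set \<open>M\<close> with a
  distance \<open>d\<close>; only the values of \<open>d\<close> on \<open>M\<close> matter. The upper limit is taken in
  the extended reals, where it always exists; it is finite whenever \<open>d\<close> is bounded, in
  particular on a compact space. The term for \<open>n = 0\<close> is \<open>0\<close> and does not affect it.
\<close>

definition besicovitch :: "('a \<Rightarrow> 'a \<Rightarrow> real) \<Rightarrow> ('a \<Rightarrow> 'a) \<Rightarrow> 'a \<Rightarrow> 'a \<Rightarrow> ereal" where
  "besicovitch d T x y =
     limsup (\<lambda>n. ereal ((1 / real n) * (\<Sum>j<n. d ((T ^^ j) x) ((T ^^ j) y))))"

definition besicovitch_Cauchy ::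
  "('a \<Rightarrow> 'a \<Rightarrow> real) \<Rightarrow> ('a \<Rightarrow> 'a) \<Rightarrow> (nat \<Rightarrow> 'a) \<Rightarrow> bool" where
  "besicovitch_Cauchy d T z \<longleftrightarrow>
     (\<forall>\<epsilon>::real. \<epsilon> > 0 \<longrightarrow>
       (\<exists>N. \<forall>n\<ge>N. \<forall>m\<ge>N. besicovitch d T (z n) (z m) < ereal \<epsilon>))"

definition besicovitch_complete ::
  "'a set \<Rightarrow> ('a \<Rightarrow> 'a \<Rightarrow> real) \<Rightarrow> ('a \<Rightarrow> 'a) \<Rightarrow> bool" where
  "besicovitch_complete M d T \<longleftrightarrow>
     (\<forall>z. range z \<subseteq> M \<and> besicovitch_Cauchy d T z \<longrightarrow>
       (\<exists>x\<in>M. (\<lambda>n. besicovitch d T (z n) x) \<longlonglongrightarrow> 0))"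

definition compact_metric_space :: "'a set \<Rightarrow> ('a \<Rightarrow> 'a \<Rightarrow> real) \<Rightarrow> bool" where
  "compact_metric_space M d \<longleftrightarrow>
     Metric_space M d \<and> compact_space (Metric_space.mtopology M d)"

text \<open>
  HOL cannot quantify existentially over types, so the points of an existentially
  quantified compact metric space are taken from the type \<open>nat \<Rightarrow> real\<close>, with an
  arbitrary carrier and an arbitrary metric on it (unrelated to any structure of the type).
  This loses no generality: given a nonempty compact metric space with a dense sequence \<open>q\<close>,
  the map \<open>x \<mapsto> (\<lambda>n. d x (q n))\<close> is injective, and transporting \<open>d\<close> along it gives an
  isometric copy with points in \<open>nat \<Rightarrow> real\<close>.
\<close>

end

theory Submission
  imports Defs "HOL-Real_Asymp.Real_Asymp"
begin

text \<open>
  On \<open>X = {(z, s, u). cmod z \<le> 1, 0 \<le> u \<le> s \<le> 1}\<close> let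
  \<open>T (z, s, u) = (z / (1 - \<i> u), s, u / (1 + u))\<close>. If \<open>u = 1 / k\<close> initially, then \<open>u\<close> runs through
  \<open>1 / k, 1 / (k + 1), \<dots>\<close>, so \<open>z\<close> rotates by a total angle that grows like a logarithm, and its
  modulus does not tend to \<open>0\<close>. Points with \<open>u = 0\<close> are fixed. Starting at \<open>s = u = 1 / n\<close>, with
  phases of \<open>z\<close> chosen such that all orbits follow the same slow rotation \<open>w\<close>, one gets points whose
  Besicovitch distances are \<open>\<bar>1 / n - 1 / m\<bar>\<close>. A limit would have \<open>s = 0\<close>, hence \<open>u = 0\<close>, and so
  would be a fixed point; but \<open>w\<close> stays at a positive mean distance from every fixed point, because
  \<open>cmod w\<close> tends to some \<open>r > 0\<close> while its means have modulus close to \<open>r / sqrt 2\<close>.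
\<close>

subsection \<open>Transport along an injection\<close>

text \<open>The metric pulled back along \<open>h\<close> makes \<open>g\<close> an isometry of
  \<open>X\<close> onto its image with inverse \<open>h\<close>, so compactness and the conjugated
  map carry over through homeomorphisms. This moves an example from a convenient type into
  \<open>nat \<Rightarrow> real\<close>.\<close>

lemma
  fixes X :: "'a::metric_space set" and g :: "'a \<Rightarrow> 'b" and h :: "'b \<Rightarrow> 'a" and T :: "'a \<Rightarrow> 'a"
  assumes inv: "\<And>x. h (g x) = x" and compact: "compact X"
    and cont: "continuous_on X T" and self_map: "T ` X \<subseteq> X"
  defines "d \<equiv> \<lambda>a b. dist (h a) (h b)"
  shows compact_metric_space_transport: "compact_metric_space (g ` X) d"
    and continuous_map_transport:
      "continuous_map (Metric_space.mtopology (g ` X) d) (Metric_space.mtopology (g ` X) d)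
         (g \<circ> T \<circ> h)"
proof -
  have ms: "Metric_space (g ` X) d"
    by (rule Metric_space.intro) (auto simp: d_def inv dist_commute dist_triangle)
  interpret S: Submetric UNIV dist X
    by (simp add: Submetric_def Submetric_axioms_def Met_TC.Metric_space_axioms)
  interpret Y: Metric_space "g ` X" d by (rule ms)
  interpret P: Metric_space12 X dist "g ` X" d
    by (simp add: Metric_space12_def S.sub.Metric_space_axioms ms)
  interpret Q: Metric_space12 "g ` X" d X dist
    by (simp add: Metric_space12_def S.sub.Metric_space_axioms ms)
  have top: "S.sub.mtopology = top_of_set X"
    using S.mtopology_submetric by simp
  have g: "homeomorphic_map (top_of_set X) Y.mtopology g"
    using P.isometry_imp_homeomorphic_map[of g] by (simp add: top d_def inv)
  have h: "homeomorphic_map Y.mtopology (top_of_set X) h"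
    using Q.isometry_imp_homeomorphic_map[of h] by (simp add: top d_def inv image_image)
  have "compact_space (top_of_set X)"
    using compact by (simp add: compact_space_subtopology)
  then have "compact_space Y.mtopology"
    using g homeomorphic_compact_space homeomorphic_map_imp_homeomorphic_space by blast
  then show "compact_metric_space (g ` X) d"
    by (simp add: compact_metric_space_def ms)
  have "continuous_map (top_of_set X) (top_of_set X) T"
    using cont self_map by auto
  then show "continuous_map Y.mtopology Y.mtopology (g \<circ> T \<circ> h)"
    using g h by (meson continuous_map_compose homeomorphic_imp_continuous_map)
qed

lemma besicovitch_transport:
  assumes inv: "\<And>x. h (g x) = x"
  shows "besicovitch (\<lambda>a b. d (h a) (h b)) (g \<circ> T \<circ> h) (g x) (g y) = besicovitch d T x y"
proof -
  have "((g \<circ> T \<circ> h) ^^ j) (g x) = g ((T ^^ j) x)" for j x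
    by (induction j) (simp_all add: inv)
  then show ?thesis by (simp add: besicovitch_def inv)
qed

text \<open>Used in contrapositive form: conjugation by \<open>g\<close> preserves all Besicovitch
  distances, so failure of completeness passes to the copy.\<close>

lemma besicovitch_complete_transport:
  assumes inv: "\<And>x. h (g x) = x"
    and "besicovitch_complete (g ` X) (\<lambda>a b. d (h a) (h b)) (g \<circ> T \<circ> h)"
  shows "besicovitch_complete X d T"
  unfolding besicovitch_complete_def
proof (intro allI impI, elim conjE)
  fix z assume "range z \<subseteq> X" "besicovitch_Cauchy d T z"
  then have "range (g \<circ> z) \<subseteq> g ` X"
    and "besicovitch_Cauchy (\<lambda>a b. d (h a) (h b)) (g \<circ> T \<circ> h) (g \<circ> z)"
    by (auto simp: besicovitch_Cauchy_def besicovitch_transport[where g=g and h=h and d=d, OF inv])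
  then obtain y where "y \<in> X"
    "(\<lambda>n. besicovitch (\<lambda>a b. d (h a) (h b)) (g \<circ> T \<circ> h) ((g \<circ> z) n) (g y)) \<longlonglongrightarrow> 0"
    using assms(2) unfolding besicovitch_complete_def by blast
  then show "\<exists>x\<in>X. (\<lambda>n. besicovitch d T (z n) x) \<longlonglongrightarrow> 0"
    by (auto simp: besicovitch_transport[where g=g and h=h and d=d, OF inv])
qed

subsection \<open>Bounds for Besicovitch distances\<close>

text \<open>The exceptional initial terms have a fixed total excess \<open>C\<close> over
  \<open>K\<close>, which adds only \<open>C / n\<close> to the n-th mean.\<close>

lemma besicovitch_le:
  assumes "\<forall>\<^sub>F j in sequentially. d ((T ^^ j) x) ((T ^^ j) y) \<le> K"
  shows "besicovitch d T x y \<le> ereal K"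
proof -
  let ?a = "\<lambda>j. d ((T ^^ j) x) ((T ^^ j) y)"
  obtain N where N: "\<And>j. j \<ge> N \<Longrightarrow> ?a j \<le> K"
    using assms by (auto simp: eventually_sequentially)
  define C where "C = (\<Sum>j<N. ?a j - K)"
  have "(1 / real n) * (\<Sum>j<n. ?a j) \<le> C / real n + K" if "n \<ge> Suc N" for n
  proof -
    have "(\<Sum>j<n. ?a j - K) = C + (\<Sum>j\<in>{N..<n}. ?a j - K)"
      unfolding C_def using that
      by (subst sum.union_disjoint[symmetric]) (auto intro!: sum.cong)
    also have "\<dots> \<le> C"
      using N by (auto intro!: sum_nonpos)
    finally show ?thesis
      using that by (simp add: sum_subtractf field_simps)
  qed
  then have ev: "\<forall>\<^sub>F n in sequentially. ereal ((1 / real n) * (\<Sum>j<n. ?a j)) \<le> ereal (C / real n + K)"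
    unfolding eventually_sequentially by (metis ereal_less_eq(3))
  have "(\<lambda>n. C / real n + K) \<longlonglongrightarrow> 0 + K"
    by (intro tendsto_intros lim_const_over_n)
  then have "(\<lambda>n. ereal (C / real n + K)) \<longlonglongrightarrow> ereal K" by simp
  with Limsup_mono[OF ev] show ?thesis
    unfolding besicovitch_def by (simp add: lim_imp_Limsup)
qed

lemma besicovitch_ge_tendsto:
  assumes "f \<longlonglongrightarrow> c"
    and "\<And>n. n > 0 \<Longrightarrow> f n \<le> (1 / real n) * (\<Sum>j<n. d ((T ^^ j) x) ((T ^^ j) y))"
  shows "ereal c \<le> besicovitch d T x y"
proof -
  have "limsup (\<lambda>n. ereal (f n)) \<le> besicovitch d T x y"
    unfolding besicovitch_def
    by (rule Limsup_mono) (use assms(2) in \<open>auto simp: eventually_sequentially intro!: exI[of _ 1]\<close>)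
  then show ?thesis
    using lim_imp_Limsup[of sequentially "\<lambda>n. ereal (f n)" "ereal c"] assms(1) by simp
qed

lemma besicovitch_ge:
  assumes "\<And>j. K \<le> d ((T ^^ j) x) ((T ^^ j) y)"
  shows "ereal K \<le> besicovitch d T x y"
proof (rule besicovitch_ge_tendsto[where f = "\<lambda>_. K"])
  fix n :: nat assume "n > 0"
  have "real n * K \<le> (\<Sum>j<n. d ((T ^^ j) x) ((T ^^ j) y))"
    using sum_bounded_below[of "{..<n}" K] assms by simp
  with \<open>n > 0\<close> show "K \<le> (1 / real n) * (\<Sum>j<n. d ((T ^^ j) x) ((T ^^ j) y))"
    by (simp add: field_simps)
qed simp

subsection \<open>The slow rotation\<close>

text \<open>This is the product of 1 / (1 - i/m) for m from 2 to k + 1, which grows like a constant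
  times k^i: bounded modulus, logarithmic phase.\<close>

fun slow :: "nat \<Rightarrow> complex" where
  "slow 0 = 1"
| "slow (Suc k) = slow k / (1 - \<i> * of_real (1 / (real k + 2)))"

lemma cmod_one_minus_i: "cmod (1 - \<i> * of_real u) = sqrt (1 + u\<^sup>2)"
  by (simp add: cmod_def)

lemma cmod_divide_one_minus_i_le: "cmod (z / (1 - \<i> * of_real u)) \<le> cmod z"
proof -
  have "1 \<le> sqrt (1 + u\<^sup>2)" by simp
  then have "cmod z / sqrt (1 + u\<^sup>2) \<le> cmod z / 1"
    by (intro divide_left_mono) (auto simp: add_pos_nonneg)
  then show ?thesis by (simp only: norm_divide cmod_one_minus_i div_by_1)
qed

lemma decseq_cmod_slow: "decseq (\<lambda>k. cmod (slow k))"
  unfolding decseq_Suc_iff slow.simps using cmod_divide_one_minus_i_le by blast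

lemma cmod_slow_le: "cmod (slow k) \<le> 1"
  using decseqD[OF decseq_cmod_slow, of 0 k] by simp

text \<open>The squared modulus is the product of 1 / (1 + 1/m^2) over m from 2 to k + 1. Each
  factor is at least 1 - 1/m^2 = (m - 1)(m + 1) / m^2, and the product of these telescopes to the
  left-hand side.\<close>

lemma cmod_slow_ge: "(real k + 2) / (2 * (real k + 1)) \<le> (cmod (slow k))\<^sup>2"
proof (induction k)
  case (Suc k)
  define m where "m = real k + 2"
  have m: "m \<ge> 2" by (simp add: m_def)
  have "(m + 1) / (2 * m) \<le> m / (2 * (m - 1)) / (1 + (1 / m)\<^sup>2)"
  proof -
    have "m / (2 * (m - 1)) / (1 + (1 / m)\<^sup>2) = m ^ 3 / (2 * (m - 1) * (m\<^sup>2 + 1))"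
      using m by (simp add: field_simps power2_eq_square power3_eq_cube)
    moreover have "(m + 1) / (2 * m) \<le> m ^ 3 / (2 * (m - 1) * (m\<^sup>2 + 1))"
    proof (subst frac_le_eq)
      show "2 * m \<noteq> 0" "2 * (m - 1) * (m\<^sup>2 + 1) \<noteq> 0"
        using m by (auto simp: add_nonneg_eq_0_iff)
      \<comment> \<open>After cross-multiplication the claim is 2 (m^4 - 1) <= 2 m^4.\<close>
      have "(m + 1) * (2 * (m - 1) * (m\<^sup>2 + 1)) - m ^ 3 * (2 * m) = -2"
        by algebra
      then show "((m + 1) * (2 * (m - 1) * (m\<^sup>2 + 1)) - m ^ 3 * (2 * m)) /
          (2 * m * (2 * (m - 1) * (m\<^sup>2 + 1))) \<le> 0"
        using m by simp
    qed
    ultimately show ?thesis by simp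
  qed
  also have "\<dots> \<le> (cmod (slow k))\<^sup>2 / (1 + (1 / m)\<^sup>2)"
    using Suc by (intro divide_right_mono) (auto simp: m_def add.commute)
  also have "\<dots> = (cmod (slow (Suc k)))\<^sup>2"
    unfolding slow.simps norm_divide cmod_one_minus_i m_def
    by (simp add: power_divide)
  finally show ?case by (simp add: m_def add.commute)
qed simp

lemma cmod_slow_tendsto:
  obtains r where "r > 0" "(\<lambda>k. cmod (slow k)) \<longlonglongrightarrow> r" "\<And>k. r \<le> cmod (slow k)"
proof -
  have half: "1 / 2 \<le> cmod (slow k)" for k
  proof (rule power2_le_imp_le)
    have "(1 / 2)\<^sup>2 \<le> (real k + 2) / (2 * (real k + 1))"
      by (simp add: field_simps power2_eq_square)
    with cmod_slow_ge[of k] show "(1 / 2)\<^sup>2 \<le> (cmod (slow k))\<^sup>2" by linarith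
  qed simp
  then obtain r where r: "(\<lambda>k. cmod (slow k)) \<longlonglongrightarrow> r" "\<forall>k. r \<le> cmod (slow k)"
    using decseq_convergent[OF decseq_cmod_slow, of "1 / 2"] by blast
  moreover have "1 / 2 \<le> r"
    using LIMSEQ_le_const[OF r(1)] half by blast
  ultimately show ?thesis using that[of r] by auto
qed

text \<open>The recursion makes the increment equal to i/(k + 2) times \<open>slow (Suc k)\<close>,
  whose modulus is at most 1.\<close>

lemma slow_Suc_diff: "(\<lambda>k. slow (Suc k) - slow k) \<longlonglongrightarrow> 0"
proof (rule Lim_null_comparison)
  have "cmod (slow (Suc k) - slow k) \<le> inverse (real (Suc k))" for k
  proof -
    define v where "v = \<i> * of_real (1 / (real k + 2))"
    have "1 - v \<noteq> 0" by (simp add: v_def complex_eq_iff)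
    then have "slow k = (1 - v) * slow (Suc k)" by (simp add: v_def)
    then have "slow (Suc k) - slow k = v * slow (Suc k)" by algebra
    moreover have "cmod v = 1 / (real k + 2)"
      unfolding v_def norm_mult norm_of_real by simp
    ultimately have "cmod (slow (Suc k) - slow k) = 1 / (real k + 2) * cmod (slow (Suc k))"
      by (simp only: norm_mult)
    also have "\<dots> \<le> 1 / (real k + 2)"
      using cmod_slow_le[of "Suc k"] by (intro mult_left_le) auto
    also have "\<dots> \<le> inverse (real (Suc k))" by (simp add: field_simps)
    finally show ?thesis .
  qed
  then show "\<forall>\<^sub>F k in sequentially. cmod (slow (Suc k) - slow k) \<le> inverse (real (Suc k))" by simp
qed (rule LIMSEQ_inverse_real_of_nat)

text \<open>A fixed shift is a sum of \<open>n\<close> vanishing increments. Hence the first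
  coordinates of all the starting points become asymptotic.\<close>

lemma slow_shift_diff: "(\<lambda>j. slow (n + j) - slow j) \<longlonglongrightarrow> 0"
proof (induction n)
  case (Suc n)
  have "(\<lambda>j. (slow (Suc (j + n)) - slow (j + n)) + (slow (n + j) - slow j)) \<longlonglongrightarrow> 0 + 0"
    by (intro tendsto_add Suc LIMSEQ_ignore_initial_segment[OF slow_Suc_diff])
  then show ?case by (simp add: add.commute del: slow.simps)
qed simp

text \<open>With F(k) = (k + 1 - i) \<open>slow k\<close>, the recursion gives F(k + 1) = (k + 2)
  \<open>slow k\<close>, so F(k + 1) - F(k) = (1 + i) \<open>slow k\<close> and the sum telescopes.
  It is the discrete form of integrating x^i to x^(1 + i) / (1 + i); the factor 1 + i is the source
  of sqrt 2 below.\<close>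

lemma sum_slow:
  "(1 + \<i>) * (\<Sum>j<N. slow (n + j)) =
     (of_nat (n + N + 1) - \<i>) * slow (n + N) - (of_nat (n + 1) - \<i>) * slow n"
proof (induction N)
  case (Suc N)
  have "complex_of_real (real (n + N) + 2) \<noteq> 0" "complex_of_real (real (n + N) + 2) - \<i> \<noteq> 0"
    by (simp_all add: complex_eq_iff)
  then have "(of_nat (n + N + 2) - \<i>) * slow (Suc (n + N)) = of_nat (n + N + 2) * slow (n + N)"
    by (simp add: field_simps)
  then show ?case using Suc
    by (simp add: algebra_simps del: slow.simps)
qed simp

text \<open>The mean distance to \<open>p\<close> is at least r - |p|, term by term, and at least
  |p| minus the modulus of the mean of \<open>slow\<close>, by the triangle inequality. Averaging
  the two bounds eliminates \<open>p\<close>, and \<open>sum_slow\<close> bounds the mean.\<close>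

lemma mean_dist_slow_ge:
  assumes "N > 0" and r: "\<And>k. r \<le> cmod (slow k)"
  shows "(r - ((real (n + 2) / real N + 1) * cmod (slow (n + N)) + real (n + 2) / real N) / sqrt 2) / 2
           \<le> (1 / real N) * (\<Sum>j<N. cmod (slow (n + j) - p))"
proof -
  let ?S = "\<Sum>j<N. slow (n + j)" and ?D = "\<Sum>j<N. cmod (slow (n + j) - p)"
  have "r - cmod p \<le> cmod (slow (n + j) - p)" for j
    using r[of "n + j"] norm_triangle_ineq2[of "slow (n + j)" p] by linarith
  then have "real N * (r - cmod p) \<le> ?D"
    using sum_bounded_below[of "{..<N}" "r - cmod p" "\<lambda>j. cmod (slow (n + j) - p)"] by simp
  moreover have "real N * cmod p - cmod ?S \<le> ?D"
  proof -
    have "real N * cmod p - cmod ?S \<le> cmod (?S - of_nat N * p)"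
      using norm_triangle_ineq2[of "of_nat N * p" ?S] by (simp add: norm_mult norm_minus_commute)
    also have "?S - of_nat N * p = (\<Sum>j<N. slow (n + j) - p)"
      by (simp add: sum_subtractf)
    also have "cmod \<dots> \<le> ?D" by (rule norm_sum)
    finally show ?thesis .
  qed
  moreover have "sqrt 2 * cmod ?S \<le> real (n + N + 2) * cmod (slow (n + N)) + real (n + 2)"
  proof -
    have le: "cmod (of_nat (k + 1) - \<i>) \<le> real (k + 2)" for k
    proof -
      have "cmod (of_nat (k + 1)) = real (k + 1)" by (rule norm_of_nat)
      then show ?thesis using norm_triangle_ineq4[of "of_nat (k + 1)" \<i>] by simp
    qed
    have "cmod (1 + \<i>) = sqrt 2"
      by (simp add: cmod_def)
    then have "sqrt 2 * cmod ?S = cmod ((1 + \<i>) * ?S)"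
      by (simp only: norm_mult)
    also have "\<dots> \<le> cmod (of_nat (n + N + 1) - \<i>) * cmod (slow (n + N))
        + cmod (of_nat (n + 1) - \<i>) * cmod (slow n)"
      unfolding sum_slow by (rule order_trans[OF norm_triangle_ineq4]) (simp only: norm_mult order_refl)
    also have "\<dots> \<le> real (n + N + 2) * cmod (slow (n + N)) + real (n + 2) * 1"
      by (intro add_mono mult_mono le cmod_slow_le) auto
    finally show ?thesis by simp
  qed
  then have "cmod ?S \<le> (real (n + N + 2) * cmod (slow (n + N)) + real (n + 2)) / sqrt 2"
    by (simp add: field_simps)
  ultimately have "real N * r - (real (n + N + 2) * cmod (slow (n + N)) + real (n + 2)) / sqrt 2 \<le> 2 * ?D"
    by (simp add: algebra_simps)
  then have le: "(real N * r - (real (n + N + 2) * cmod (slow (n + N)) + real (n + 2)) / sqrt 2) / (2 * real N)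
      \<le> 2 * ?D / (2 * real N)"
    by (rule divide_right_mono) simp
  have eq: "(r - ((real (n + 2) / real N + 1) * x + real (n + 2) / real N) / t) / 2
      = (real N * r - (real (n + N + 2) * x + real (n + 2)) / t) / (2 * real N)" if "t \<noteq> 0" for x t
    using \<open>N > 0\<close> that by (simp add: field_simps)
  have nz: "sqrt 2 \<noteq> (0::real)" by simp
  have "2 * ?D / (2 * real N) = (1 / real N) * ?D" by simp
  then show ?thesis
    unfolding eq[OF nz] by (rule ord_le_eq_trans[OF le])
qed

subsection \<open>The system\<close>

definition spiral_space :: "(complex \<times> real \<times> real) set" where
  "spiral_space = {(z, s, u). cmod z \<le> 1 \<and> 0 \<le> u \<and> u \<le> s \<and> s \<le> 1}"

definition spiral_map :: "complex \<times> real \<times> real \<Rightarrow> complex \<times> real \<times> real" where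
  "spiral_map = (\<lambda>(z, s, u). (z / (1 - \<i> * of_real u), s, u / (1 + u)))"

text \<open>The first and third coordinates are those of the orbit of \<open>spiral_start 0\<close>
  at time \<open>n\<close>, so that iteration merely shifts the index there.\<close>

definition spiral_start :: "nat \<Rightarrow> complex \<times> real \<times> real" where
  "spiral_start n = (slow n, 1 / (real n + 2), 1 / (real n + 2))"

lemma compact_spiral_space: "compact spiral_space"
proof -
  have "closed {p :: complex \<times> real \<times> real. snd (snd p) \<le> fst (snd p)}"
    by (intro closed_Collect_le continuous_intros)
  then have "compact ((cball 0 1 \<times> {0..1} \<times> {0..1}) \<inter> {p :: complex \<times> real \<times> real. snd (snd p) \<le> fst (snd p)})"
    by (intro compact_Int_closed compact_Times compact_cball compact_Icc)
  also have "(cball 0 1 \<times> {0..1} \<times> {0..1}) \<inter> {p. snd (snd p) \<le> fst (snd p)} = spiral_space"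
    by (auto simp: spiral_space_def)
  finally show ?thesis .
qed

lemma spiral_map_self: "spiral_map ` spiral_space \<subseteq> spiral_space"
proof -
  have "u / (1 + u) \<le> u" if "0 \<le> u" for u :: real
    using that by (simp add: field_simps)
  then show ?thesis
    using cmod_divide_one_minus_i_le order_trans
    by (fastforce simp: spiral_space_def spiral_map_def)
qed

lemma continuous_on_spiral_map: "continuous_on spiral_space spiral_map"
proof -
  have "1 - \<i> * of_real u \<noteq> 0" for u :: real
    by (simp add: complex_eq_iff)
  then show ?thesis
    unfolding spiral_map_def case_prod_unfold
    by (intro continuous_intros) (auto simp: spiral_space_def)
qed

lemma spiral_start_in: "spiral_start n \<in> spiral_space"
  by (simp add: spiral_start_def spiral_space_def cmod_slow_le)

lemma spiral_map_funpow_start: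
  "(spiral_map ^^ j) (spiral_start n) = (slow (n + j), 1 / (real n + 2), 1 / (real (n + j) + 2))"
proof (induction j)
  case (Suc j)
  have "1 / (real (n + j) + 2) / (1 + 1 / (real (n + j) + 2)) = 1 / (real (n + Suc j) + 2)"
    by (simp add: field_simps)
  then show ?case using Suc by (simp add: spiral_map_def)
qed (simp add: spiral_start_def)

lemma fst_snd_spiral_map_funpow: "fst (snd ((spiral_map ^^ j) p)) = fst (snd p)"
  by (induction j) (simp_all add: spiral_map_def case_prod_unfold)

lemma spiral_map_funpow_fixed: "(spiral_map ^^ j) (z, s, 0) = (z, s, 0)"
  by (induction j) (simp_all add: spiral_map_def)

text \<open>Along two such orbits the first and third coordinates become asymptotically equal, so
  the distance converges to that of the constant second coordinates.\<close>

lemma besicovitch_Cauchy_spiral_start: "besicovitch_Cauchy dist spiral_map spiral_start"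
  unfolding besicovitch_Cauchy_def
proof (intro allI impI)
  fix e :: real assume "e > 0"
  have inv0: "(\<lambda>n. 1 / (real n + 2)) \<longlonglongrightarrow> 0"
    by real_asymp
  then have "Cauchy (\<lambda>n. 1 / (real n + 2))"
    by (rule LIMSEQ_imp_Cauchy)
  \<comment> \<open>Half of \<open>e\<close> leaves room because \<open>besicovitch_le\<close>
    yields only a non-strict bound.\<close>
  then obtain N where N: "\<And>n m. n \<ge> N \<Longrightarrow> m \<ge> N \<Longrightarrow> dist (1 / (real n + 2)) (1 / (real m + 2)) < e / 2"
    using \<open>e > 0\<close> unfolding Cauchy_def by (meson half_gt_zero)
  have "besicovitch dist spiral_map (spiral_start n) (spiral_start m) < ereal e"
    if nm: "n \<ge> N" "m \<ge> N" for n m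
  proof -
    have "(\<lambda>j. dist (slow (n + j) - slow j) (slow (m + j) - slow j)) \<longlonglongrightarrow> dist (0::complex) 0"
      by (intro tendsto_dist slow_shift_diff)
    then have slow: "(\<lambda>j. dist (slow (n + j)) (slow (m + j))) \<longlonglongrightarrow> dist (0::complex) 0"
      by (simp add: dist_norm)
    have eq: "sqrt ((dist (0::complex) 0)\<^sup>2 + (dist (a, 0::real) (b, 0))\<^sup>2) = dist a b" for a b :: real
      by (simp add: dist_Pair_Pair)
    have "(\<lambda>j. 1 / (real (k + j) + 2)) \<longlonglongrightarrow> 0" for k
      using LIMSEQ_ignore_initial_segment[OF inv0, of k] by (simp add: add.commute)
    then have rest: "(\<lambda>j. dist (1 / (real n + 2), 1 / (real (n + j) + 2)) (1 / (real m + 2), 1 / (real (m + j) + 2)))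
        \<longlonglongrightarrow> dist (1 / (real n + 2), 0::real) (1 / (real m + 2), 0)"
      by (intro tendsto_dist tendsto_Pair tendsto_const)
    have "(\<lambda>j. dist ((spiral_map ^^ j) (spiral_start n)) ((spiral_map ^^ j) (spiral_start m)))
      \<longlonglongrightarrow> sqrt ((dist (0::complex) 0)\<^sup>2 + (dist (1 / (real n + 2), 0::real) (1 / (real m + 2), 0))\<^sup>2)"
      unfolding spiral_map_funpow_start dist_Pair_Pair[of "slow _"]
      by (intro tendsto_real_sqrt tendsto_add tendsto_power slow rest)
    then have "(\<lambda>j. dist ((spiral_map ^^ j) (spiral_start n)) ((spiral_map ^^ j) (spiral_start m)))
      \<longlonglongrightarrow> dist (1 / (real n + 2)) (1 / (real m + 2))"
      by (simp only: eq)
    then have "\<forall>\<^sub>F j in sequentially. dist ((spiral_map ^^ j) (spiral_start n))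
        ((spiral_map ^^ j) (spiral_start m)) < e / 2"
      by (rule order_tendstoD) (rule N[OF nm])
    then have "besicovitch dist spiral_map (spiral_start n) (spiral_start m) \<le> ereal (e / 2)"
      by (intro besicovitch_le) (auto elim: eventually_mono)
    also have "\<dots> < ereal e" using \<open>e > 0\<close> by simp
    finally show ?thesis .
  qed
  then show "\<exists>N. \<forall>n\<ge>N. \<forall>m\<ge>N. besicovitch dist spiral_map (spiral_start n) (spiral_start m) < ereal e"
    by blast
qed

lemma besicovitch_spiral_start_fixed_ge:
  obtains c where "c > 0"
    "\<And>n p. ereal c \<le> besicovitch dist spiral_map (spiral_start n) (p, 0, 0)"
proof -
  obtain r where r: "r > 0" "(\<lambda>k. cmod (slow k)) \<longlonglongrightarrow> r" "\<And>k. r \<le> cmod (slow k)"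
    by (rule cmod_slow_tendsto) blast
  \<comment> \<open>This is the limit of the lower bound in \<open>mean_dist_slow_ge\<close> as
    \<open>N\<close> grows; it depends on neither \<open>n\<close> nor \<open>p\<close>, and is
    positive since sqrt 2 > 1.\<close>
  define c where "c = (r - r / sqrt 2) / 2"
  have "ereal c \<le> besicovitch dist spiral_map (spiral_start n) (p, 0, 0)" for n p
  proof (rule besicovitch_ge_tendsto)
    have "(\<lambda>N. cmod (slow (n + N))) \<longlonglongrightarrow> r"
      using LIMSEQ_ignore_initial_segment[OF r(2), of n] by (simp add: add.commute)
    then have "(\<lambda>N. (r - ((real (n + 2) / real N + 1) * cmod (slow (n + N)) + real (n + 2) / real N) / sqrt 2) / 2)
        \<longlonglongrightarrow> (r - ((0 + 1) * r + 0) / sqrt 2) / 2"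
      by (intro tendsto_intros lim_const_over_n) simp_all
    then show "(\<lambda>N. (r - ((real (n + 2) / real N + 1) * cmod (slow (n + N)) + real (n + 2) / real N) / sqrt 2) / 2)
        \<longlonglongrightarrow> c"
      by (simp add: c_def)
  next
    fix N :: nat assume "N > 0"
    have "cmod (slow (n + j) - p) \<le> dist ((spiral_map ^^ j) (spiral_start n)) ((spiral_map ^^ j) (p, 0, 0))" for j
      using dist_fst_le[of "(spiral_map ^^ j) (spiral_start n)" "(p, 0, 0)"]
      by (simp add: spiral_map_funpow_start spiral_map_funpow_fixed dist_norm)
    then have "(1 / real N) * (\<Sum>j<N. cmod (slow (n + j) - p))
        \<le> (1 / real N) * (\<Sum>j<N. dist ((spiral_map ^^ j) (spiral_start n)) ((spiral_map ^^ j) (p, 0, 0)))"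
      by (intro mult_left_mono sum_mono) auto
    with mean_dist_slow_ge[OF \<open>N > 0\<close> r(3), of n p]
    show "(r - ((real (n + 2) / real N + 1) * cmod (slow (n + N)) + real (n + 2) / real N) / sqrt 2) / 2
        \<le> (1 / real N) * (\<Sum>j<N. dist ((spiral_map ^^ j) (spiral_start n)) ((spiral_map ^^ j) (p, 0, 0)))"
      by (rule order_trans)
  qed
  moreover have "c > 0"
    using r(1) by (simp add: c_def divide_less_eq mult_less_cancel_left1)
  ultimately show ?thesis using that by blast
qed

lemma not_besicovitch_complete_spiral: "\<not> besicovitch_complete spiral_space dist spiral_map"
proof
  assume "besicovitch_complete spiral_space dist spiral_map"
  then obtain z s u where x: "(z, s, u) \<in> spiral_space"
    and lim: "(\<lambda>n. besicovitch dist spiral_map (spiral_start n) (z, s, u)) \<longlonglongrightarrow> 0"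
    unfolding besicovitch_complete_def
    using spiral_start_in besicovitch_Cauchy_spiral_start by (metis image_subsetI prod_cases3)
  \<comment> \<open>The second coordinate is invariant, so its gap persists at every time; letting
    \<open>n\<close> grow forces \<open>s = 0\<close>.\<close>
  have ge: "ereal \<bar>1 / (real n + 2) - s\<bar> \<le> besicovitch dist spiral_map (spiral_start n) (z, s, u)" for n
  proof (rule besicovitch_ge)
    fix j
    let ?p = "(spiral_map ^^ j) (spiral_start n)" and ?q = "(spiral_map ^^ j) (z, s, u)"
    have "dist (fst (snd ?p)) (fst (snd ?q)) \<le> dist ?p ?q"
      using dist_fst_le dist_snd_le order_trans by blast
    then show "\<bar>1 / (real n + 2) - s\<bar> \<le> dist ?p ?q"
      by (simp add: fst_snd_spiral_map_funpow dist_real_def) (simp add: spiral_start_def)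
  qed
  have "(\<lambda>n. \<bar>1 / (real n + 2) - s\<bar>) \<longlonglongrightarrow> \<bar>0 - s\<bar>"
    by (intro tendsto_intros) real_asymp
  then have "(\<lambda>n. ereal \<bar>1 / (real n + 2) - s\<bar>) \<longlonglongrightarrow> ereal \<bar>s\<bar>" by simp
  then have "ereal \<bar>s\<bar> \<le> 0"
    using lim by (rule LIMSEQ_le) (use ge in blast)
  \<comment> \<open>The constraint 0 <= \<open>u\<close> <= \<open>s\<close> now makes the limit a
    fixed point, which stays uniformly far from all starting points.\<close>
  then have "s = 0" "u = 0" using x by (auto simp: spiral_space_def)
  then obtain c where "c > 0"
    "\<And>n. ereal c \<le> besicovitch dist spiral_map (spiral_start n) (z, s, u)"
    using besicovitch_spiral_start_fixed_ge by metis
  then have "ereal c \<le> 0"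
    using LIMSEQ_le_const[OF lim] by blast
  with \<open>c > 0\<close> show False by simp
qed

theorem mainTheorem3:
  "\<exists>(M :: (nat \<Rightarrow> real) set) (d :: (nat \<Rightarrow> real) \<Rightarrow> (nat \<Rightarrow> real) \<Rightarrow> real)
      (T :: (nat \<Rightarrow> real) \<Rightarrow> (nat \<Rightarrow> real)).
     compact_metric_space M d \<and>
     continuous_map (Metric_space.mtopology M d) (Metric_space.mtopology M d) T \<and>
     \<not> besicovitch_complete M d T"
proof -
  \<comment> \<open>The four real coordinates become entries 0 to 3, with \<open>u\<close> repeated
    afterwards; \<open>h\<close> reads these four entries back.\<close>
  define g :: "complex \<times> real \<times> real \<Rightarrow> nat \<Rightarrow> real" where
    "g = (\<lambda>(z, s, u) i. if i = 0 then Re z else if i = 1 then Im z else if i = 2 then s else u)"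
  define h :: "(nat \<Rightarrow> real) \<Rightarrow> complex \<times> real \<times> real" where
    "h = (\<lambda>f. (Complex (f 0) (f 1), f 2, f 3))"
  have inv: "h (g x) = x" for x
    by (cases x) (simp add: g_def h_def)
  let ?M = "g ` spiral_space" and ?d = "\<lambda>a b. dist (h a) (h b)" and ?T = "g \<circ> spiral_map \<circ> h"
  have "compact_metric_space ?M ?d"
    "continuous_map (Metric_space.mtopology ?M ?d) (Metric_space.mtopology ?M ?d) ?T"
    using compact_metric_space_transport[where h = h and g = g, OF inv compact_spiral_space continuous_on_spiral_map spiral_map_self]
      continuous_map_transport[where h = h and g = g, OF inv compact_spiral_space continuous_on_spiral_map spiral_map_self]
    by simp_all
  moreover have "\<not> besicovitch_complete ?M ?d ?T"
    using besicovitch_complete_transport[where d = dist and h = h and g = g, OF inv] not_besicovitch_complete_spiral by blast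
  ultimately show ?thesis by blast
qed

end
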